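(* Let $M$, $N$, $K$ be matroids on pairwise disjoint finite sets $S$, $T$, $U$, and let $A\subseteq S$, $B\subseteq T$, $C\subseteq U$. Then \[((M,N;A,B),K;A\cup B,C)=(M,(N,K;B,C);A,B\cup C).\]
   Context: For matroids $M'$ on $S'$ and $N'$ on $T'$ with $S'\cap T'=\emptyset$, and $A'\subseteq S'$, $B'\subseteq T'$, the principal sum $(M',N';A',B')$ is the matroid union $M'^+(A',B')\vee N'_0$, where: $N'_0=N'\oplus U_{0,S'}$ ($N'$ with the elements of $S'$ added as loops); $M'^+(A',B')$ is the matroid on $S'\cup T'$ obtained from $M'$ by adding each element of $B'$ freely (by successive principal extensions) to the flat $\mathrm{cl}_{M'}(A')$ and each element of $T'-B'$ as a loop, equivalently the matroid with rank function $r(X\cup Y)=\min\{r_{M'}(X\cup A'),\,r_{M'}(X)+|Y\cap B'|\}$ for $X\subseteq S'$, $Y\subseteq T'$; and the matroid union $G\vee H$ of matroids on a common set has as independent sets the unions of an independent set of $G$ and an independent set of $H$. *)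

theory Defs
  imports Main
begin

record 'a matroid =
  ground :: "'a set"
  indep :: "'a set set"

locale matroid =
  fixes M :: "'a matroid"
  assumes finite_ground: "finite (ground M)"
    and indep_subset_ground: "I \<in> indep M \<Longrightarrow> I \<subseteq> ground M"
    and empty_indep: "{} \<in> indep M"
    and indep_subset: "\<lbrakk>I \<in> indep M; J \<subseteq> I\<rbrakk> \<Longrightarrow> J \<in> indep M"
    and augmentation: "\<lbrakk>I \<in> indep M; J \<in> indep M; card I < card J\<rbrakk> \<Longrightarrow>
      \<exists>x\<in>J - I. insert x I \<in> indep M"

definition rank :: "'a matroid \<Rightarrow> 'a set \<Rightarrow> nat" where
  "rank M X = Max (card ` {I \<in> indep M. I \<subseteq> X})"

definition closure :: "'a matroid \<Rightarrow> 'a set \<Rightarrow> 'a set" where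
  "closure M X = {e \<in> ground M. rank M (insert e X) = rank M X}"

definition uniform :: "nat \<Rightarrow> 'a set \<Rightarrow> 'a matroid" where
  "uniform k E = \<lparr>ground = E, indep = {I. I \<subseteq> E \<and> card I \<le> k}\<rparr>"

definition direct_sum :: "'a matroid \<Rightarrow> 'a matroid \<Rightarrow> 'a matroid" where
  "direct_sum M N = \<lparr>ground = ground M \<union> ground N,
                     indep = {I \<union> J | I J. I \<in> indep M \<and> J \<in> indep N}\<rparr>"

(* The union of matroids on a common ground set; it is only applied when
   ground G = ground H. *)
definition matroid_union :: "'a matroid \<Rightarrow> 'a matroid \<Rightarrow> 'a matroid" where
  "matroid_union G H = \<lparr>ground = ground G \<union> ground H,
                        indep = {I \<union> J | I J. I \<in> indep G \<and> J \<in> indep H}\<rparr>"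

definition matroid_of_rank :: "'a set \<Rightarrow> ('a set \<Rightarrow> nat) \<Rightarrow> 'a matroid" where
  "matroid_of_rank E r = \<lparr>ground = E, indep = {I. I \<subseteq> E \<and> r I = card I}\<rparr>"

(* The set argument Z stands for X \<union> Y with X = Z \<inter> ground M and Y = Z - ground M, so that
   Y \<inter> B = Z \<inter> B whenever B is disjoint from ground M. *)
definition plus_rank :: "'a matroid \<Rightarrow> 'a set \<Rightarrow> 'a set \<Rightarrow> 'a set \<Rightarrow> nat" where
  "plus_rank M A B Z = min (rank M (Z \<inter> ground M \<union> A)) (rank M (Z \<inter> ground M) + card (Z \<inter> B))"

(* The extension M\<^sup>+(A, B) of M to ground M \<union> T, for A \<subseteq> ground M and B \<subseteq> T with T disjoint
   from ground M. The lemmas plus_ext_empty, plus_ext_insert and plus_ext_loop below show that it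
   arises from M by adding the elements of B one after another by principal extensions and the
   elements of T - B as loops. *)
definition plus_ext :: "'a matroid \<Rightarrow> 'a set \<Rightarrow> 'a set \<Rightarrow> 'a set \<Rightarrow> 'a matroid" where
  "plus_ext M A B T = matroid_of_rank (ground M \<union> T) (plus_rank M A B)"

definition principal_sum :: "'a matroid \<Rightarrow> 'a matroid \<Rightarrow> 'a set \<Rightarrow> 'a set \<Rightarrow> 'a matroid" where
  "principal_sum M N A B =
     matroid_union (plus_ext M A B (ground N)) (direct_sum N (uniform 0 (ground M)))"

(* The principal extension of M that adds a new element e freely to the flat F. *)
definition principal_ext :: "'a matroid \<Rightarrow> 'a set \<Rightarrow> 'a \<Rightarrow> 'a matroid" where
  "principal_ext M F e = \<lparr>ground = insert e (ground M),
     indep = {I. I - {e} \<in> indep M \<and> (e \<in> I \<longrightarrow> \<not> F \<subseteq> closure M (I - {e}))}\<rparr>"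


context matroid
begin

lemma finite_indep: "I \<in> indep M \<Longrightarrow> finite I"
  using finite_ground indep_subset_ground finite_subset by blast

lemma finite_indeps: "finite {I \<in> indep M. I \<subseteq> X}"
  by (rule finite_subset[of _ "Pow (ground M)"]) (use finite_ground indep_subset_ground in auto)

lemma rank_ge: "I \<in> indep M \<Longrightarrow> I \<subseteq> X \<Longrightarrow> card I \<le> rank M X"
  unfolding rank_def using finite_indeps by (intro Max_ge) auto

lemma rank_obtain: obtains I where "I \<in> indep M" "I \<subseteq> X" "card I = rank M X"
proof -
  have "rank M X \<in> card ` {I \<in> indep M. I \<subseteq> X}"
    unfolding rank_def using finite_indeps empty_indep by (intro Max_in) auto
  then show ?thesis using that by auto
qed

lemma rank_mono: "X \<subseteq> Y \<Longrightarrow> rank M X \<le> rank M Y"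
  by (metis rank_obtain rank_ge subset_trans)

lemma rank_le_card: "finite X \<Longrightarrow> rank M X \<le> card X"
  by (metis rank_obtain card_mono)

lemma rank_indep: "I \<in> indep M \<Longrightarrow> rank M I = card I"
  by (meson rank_ge rank_le_card finite_indep le_antisym subset_refl)

lemma indep_iff_rank: "I \<subseteq> ground M \<Longrightarrow> I \<in> indep M \<longleftrightarrow> rank M I = card I"
  by (metis rank_indep rank_obtain card_subset_eq finite_ground finite_subset)

lemma extend_indep:
  assumes "I \<in> indep M" "I \<subseteq> X"
  obtains J where "J \<in> indep M" "I \<subseteq> J" "J \<subseteq> X" "card J = rank M X"
proof -
  have "\<exists>J. J \<in> indep M \<and> I \<subseteq> J \<and> J \<subseteq> X \<and> card J = rank M X"
    using assms
  proof (induction "rank M X - card I" arbitrary: I)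
    case 0
    then show ?case using rank_ge[of I X] by force
  next
    case (Suc n)
    obtain K where K: "K \<in> indep M" "K \<subseteq> X" "card K = rank M X" by (rule rank_obtain)
    then have "card I < card K" using Suc.hyps(2) by linarith
    then obtain x where x: "x \<in> K - I" "insert x I \<in> indep M"
      using augmentation Suc.prems K by blast
    then have "n = rank M X - card (insert x I)"
      using Suc.hyps(2) finite_indep[OF Suc.prems(1)] by simp
    from Suc.hyps(1)[OF this x(2)] show ?case using x K(2) Suc.prems(2) by auto
  qed
  then show ?thesis using that by blast
qed

lemma rank_submodular: "rank M (X \<union> Y) + rank M (X \<inter> Y) \<le> rank M X + rank M Y"
proof -
  obtain I where I: "I \<in> indep M" "I \<subseteq> X \<inter> Y" "card I = rank M (X \<inter> Y)" by (rule rank_obtain)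
  obtain J where J: "J \<in> indep M" "I \<subseteq> J" "J \<subseteq> X \<union> Y" "card J = rank M (X \<union> Y)"
    using extend_indep[OF I(1), of "X \<union> Y"] I(2) by blast
  have fJ: "finite J" using finite_indep J(1) .
  have "card (J \<inter> X) \<le> rank M X" "card (J \<inter> Y) \<le> rank M Y"
    by (auto intro!: rank_ge indep_subset[OF J(1)])
  moreover have "card (J \<inter> X) + card (J \<inter> Y) = card J + card (J \<inter> (X \<inter> Y))"
    using card_Un_Int[of "J \<inter> X" "J \<inter> Y"] fJ J(3)
    by (simp add: Int_Un_distrib[symmetric] Int_absorb2 Int_left_commute Int_assoc)
  moreover have "card I \<le> card (J \<inter> (X \<inter> Y))"
    using I(2) J(2) fJ by (intro card_mono) auto
  ultimately show ?thesis using I(3) J(4) by linarith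
qed

end


lemma matroid_of_rank:
  fixes r :: "'a set \<Rightarrow> nat"
  assumes fin: "finite E"
    and empty: "r {} = 0"
    and mono: "\<And>X Y. X \<subseteq> Y \<Longrightarrow> Y \<subseteq> E \<Longrightarrow> r X \<le> r Y"
    and insert: "\<And>X x. insert x X \<subseteq> E \<Longrightarrow> r (insert x X) \<le> Suc (r X)"
    and submod: "\<And>X Y. X \<subseteq> E \<Longrightarrow> Y \<subseteq> E \<Longrightarrow> r (X \<union> Y) + r (X \<inter> Y) \<le> r X + r Y"
  shows "matroid (matroid_of_rank E r)"
    and "X \<subseteq> E \<Longrightarrow> rank (matroid_of_rank E r) X = r X"
proof -
  let ?M = "matroid_of_rank E r"
  have finE: "finite X" if "X \<subseteq> E" for X using fin finite_subset that by blast
  have diff: "r Y \<le> r X + card (Y - X)" if "X \<subseteq> Y" "Y \<subseteq> E" for X Y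
  proof -
    have "r (X \<union> D) \<le> r X + card D" if "finite D" "X \<union> D \<subseteq> E" for D
      using that
    proof (induction D rule: finite_induct)
      case (insert x D)
      then show ?case using assms(4)[of x "X \<union> D"] by simp
    qed simp
    from this[of "Y - X"] show ?thesis using that finE
      by (simp add: Un_absorb1)
  qed
  have le_card: "r X \<le> card X" if "X \<subseteq> E" for X
    using diff[of "{}" X] that empty by simp
  have span: "r (I \<union> D) = r I" if "I \<union> D \<subseteq> E" "\<And>x. x \<in> D \<Longrightarrow> r (insert x I) = r I" for I D
  proof -
    have "finite D" using that finE by simp
    then show ?thesis using that
    proof (induction D rule: finite_induct)
      case (insert x D)
      have "r (insert x I \<union> (I \<union> D)) + r (insert x I \<inter> (I \<union> D)) \<le> r (insert x I) + r (I \<union> D)"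
        using insert.prems by (intro submod) auto
      moreover have "r I \<le> r (insert x I \<inter> (I \<union> D))"
        using insert.prems by (intro mono) auto
      moreover have "r I \<le> r (I \<union> insert x D)"
        using insert.prems by (intro mono) auto
      moreover have "insert x I \<union> (I \<union> D) = I \<union> insert x D" by auto
      moreover have "r (I \<union> D) = r I" using insert by auto
      ultimately show ?case using insert.prems by simp
    qed simp
  qed
  have ins: "r (insert x I) = card (insert x I)"
    if "insert x I \<subseteq> E" "r I = card I" "x \<notin> I" "r (insert x I) \<noteq> r I" for x I
  proof -
    have "r I \<le> r (insert x I)" by (rule mono) (use that in auto)
    moreover have "card (insert x I) = Suc (card I)" using that finE[of I] by simp
    ultimately show ?thesis using insert[OF that(1)] that(2,4) by linarith
  qed
  show *: "matroid ?M"
  proof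
    fix I J assume "I \<in> indep ?M" "J \<subseteq> I"
    then have "I \<subseteq> E" "r I = card I" "J \<subseteq> I" by (auto simp: matroid_of_rank_def)
    moreover from this have "finite I" "J \<subseteq> E" using finE by auto
    moreover from calculation have "card (I - J) = card I - card J" "card J \<le> card I"
      by (auto intro: card_Diff_subset card_mono dest: finite_subset)
    ultimately have "r J = card J" using diff[of J I] le_card[of J] by linarith
    then show "J \<in> indep ?M" using \<open>J \<subseteq> E\<close> by (simp add: matroid_of_rank_def)
  next
    fix I J assume "I \<in> indep ?M" "J \<in> indep ?M" and lt: "card I < card J"
    then have IJ: "I \<subseteq> E" "r I = card I" "J \<subseteq> E" "r J = card J"
      by (auto simp: matroid_of_rank_def)
    have "\<exists>x\<in>J - I. r (insert x I) \<noteq> r I"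
    proof (rule ccontr)
      assume "\<not> ?thesis"
      then have "r (I \<union> (J - I)) = r I" using IJ by (intro span) auto
      then show False using mono[of J "I \<union> J"] IJ lt by simp
    qed
    then obtain x where x: "x \<in> J - I" "r (insert x I) \<noteq> r I" by blast
    then have "insert x I \<in> indep ?M"
      using ins[of x I] IJ by (auto simp: matroid_of_rank_def)
    then show "\<exists>x\<in>J - I. insert x I \<in> indep ?M" using x by blast
  qed (use fin empty in \<open>auto simp: matroid_of_rank_def\<close>)
  interpret matroid ?M by (fact *)
  show "rank ?M X = r X" if X: "X \<subseteq> E"
  proof -
    obtain I where I: "I \<in> indep ?M" "I \<subseteq> X" "card I = rank ?M X" by (rule rank_obtain)
    then have rI: "r I = card I" "I \<subseteq> E" by (auto simp: matroid_of_rank_def)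
    have "r (insert x I) = r I" if "x \<in> X - I" for x
    proof (rule ccontr)
      assume "r (insert x I) \<noteq> r I"
      then have "insert x I \<in> indep ?M"
        using ins[of x I] rI that X by (auto simp: matroid_of_rank_def)
      then have "card (insert x I) \<le> rank ?M X" using that I by (intro rank_ge) auto
      then show False using I that finE[OF rI(2)] by simp
    qed
    then have "r (I \<union> (X - I)) = r I" using X rI by (intro span) auto
    then show ?thesis using I rI by (simp add: Un_absorb1)
  qed
qed

context matroid
begin

context
  fixes A B T :: "'a set"
  assumes A: "A \<subseteq> ground M" and B: "B \<subseteq> T" and T: "finite T" "T \<inter> ground M = {}"
begin

lemma plus_ext:
  shows matroid_plus_ext: "matroid (plus_ext M A B T)"
    and rank_plus_ext_eq:
      "Z \<subseteq> ground M \<union> T \<Longrightarrow> rank (plus_ext M A B T) Z = plus_rank M A B Z"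
proof -
  let ?r = "plus_rank M A B" and ?E = "ground M \<union> T" and ?S = "ground M"
  have finB: "finite B" using B T finite_subset by blast
  have 1: "finite ?E" using finite_ground T by simp
  have 2: "?r {} = 0" using rank_le_card[of "{}"] by (simp add: plus_rank_def)
  have 3: "?r X \<le> ?r Y" if "X \<subseteq> Y" "Y \<subseteq> ?E" for X Y
  proof -
    have "rank M (X \<inter> ?S \<union> A) \<le> rank M (Y \<inter> ?S \<union> A)" "rank M (X \<inter> ?S) \<le> rank M (Y \<inter> ?S)"
      "card (X \<inter> B) \<le> card (Y \<inter> B)"
      using that finB by (auto intro!: rank_mono card_mono)
    then show ?thesis unfolding plus_rank_def by linarith
  qed
  have rank_insert: "rank M (insert x X) \<le> Suc (rank M X)" for x X
    using rank_submodular[of "{x}" X] rank_le_card[of "{x}"] by simp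
  have 4: "?r (insert x X) \<le> Suc (?r X)" if "insert x X \<subseteq> ?E" for x X
  proof (cases "x \<in> ?S")
    case True
    then have "x \<notin> B" using B T by auto
    then show ?thesis
      using True rank_insert[of x "X \<inter> ?S"] rank_insert[of x "X \<inter> ?S \<union> A"]
      by (auto simp: plus_rank_def min_le_iff_disj min_def)
  next
    case False
    have "card (insert x X \<inter> B) \<le> Suc (card (X \<inter> B))"
      using finB by (cases "x \<in> B") (auto simp: card_insert_if)
    then show ?thesis using False by (auto simp: plus_rank_def min_def)
  qed
  have 5: "?r (X \<union> Y) + ?r (X \<inter> Y) \<le> ?r X + ?r Y" for X Y
  proof -
    have c: "card ((X \<union> Y) \<inter> B) + card (X \<inter> Y \<inter> B) = card (X \<inter> B) + card (Y \<inter> B)"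
    proof -
      have "(X \<union> Y) \<inter> B = X \<inter> B \<union> Y \<inter> B" "X \<inter> Y \<inter> B = X \<inter> B \<inter> (Y \<inter> B)" by auto
      then show ?thesis using card_Un_Int[of "X \<inter> B" "Y \<inter> B"] finB by simp
    qed
    have m: "card (X \<inter> Y \<inter> B) \<le> card (X \<inter> B)" "card (X \<inter> Y \<inter> B) \<le> card (Y \<inter> B)"
      using finB by (auto intro!: card_mono)
    note s = rank_submodular
    have a: "rank M ((X \<union> Y) \<inter> ?S \<union> A) + rank M ((X \<inter> Y) \<inter> ?S \<union> A)
        \<le> rank M (X \<inter> ?S \<union> A) + rank M (Y \<inter> ?S \<union> A)"
    proof -
      have "(X \<union> Y) \<inter> ?S \<union> A = (X \<inter> ?S \<union> A) \<union> (Y \<inter> ?S \<union> A)"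
        "X \<inter> Y \<inter> ?S \<union> A = (X \<inter> ?S \<union> A) \<inter> (Y \<inter> ?S \<union> A)" by auto
      then show ?thesis using s[of "X \<inter> ?S \<union> A" "Y \<inter> ?S \<union> A"] by simp
    qed
    have b: "rank M ((X \<union> Y) \<inter> ?S) + rank M ((X \<inter> Y) \<inter> ?S)
        \<le> rank M (X \<inter> ?S) + rank M (Y \<inter> ?S)"
    proof -
      have "(X \<union> Y) \<inter> ?S = X \<inter> ?S \<union> Y \<inter> ?S" "X \<inter> Y \<inter> ?S = X \<inter> ?S \<inter> (Y \<inter> ?S)" by auto
      then show ?thesis using s[of "X \<inter> ?S" "Y \<inter> ?S"] by simp
    qed
    have mix: "rank M ((V \<union> W) \<inter> ?S \<union> A) + rank M ((V \<inter> W) \<inter> ?S)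
        \<le> rank M (V \<inter> ?S \<union> A) + rank M (W \<inter> ?S)" for V W
    proof -
      have "(V \<inter> ?S \<union> A) \<union> W \<inter> ?S = (V \<union> W) \<inter> ?S \<union> A" by auto
      moreover have "rank M ((V \<inter> W) \<inter> ?S) \<le> rank M ((V \<inter> ?S \<union> A) \<inter> (W \<inter> ?S))"
        by (rule rank_mono) auto
      ultimately show ?thesis using s[of "V \<inter> ?S \<union> A" "W \<inter> ?S"] by simp
    qed
    show ?thesis
      using a b c m mix[of X Y] mix[of Y X]
      unfolding plus_rank_def Un_commute[of Y X] Int_commute[of Y X] by linarith
  qed
  show "matroid (plus_ext M A B T)"
    unfolding plus_ext_def by (rule matroid_of_rank(1)[OF 1 2 3 4 5])
  show "Z \<subseteq> ?E \<Longrightarrow> rank (plus_ext M A B T) Z = ?r Z"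
    unfolding plus_ext_def by (rule matroid_of_rank(2)[OF 1 2 3 4 5])
qed

lemma rank_plus_ext:
  assumes "X \<subseteq> ground M" "Y \<subseteq> T"
  shows "rank (plus_ext M A B T) (X \<union> Y) = min (rank M (X \<union> A)) (rank M X + card (Y \<inter> B))"
proof -
  have "(X \<union> Y) \<inter> ground M = X" "(X \<union> Y) \<inter> B = Y \<inter> B" using assms B T by auto
  then show ?thesis using rank_plus_ext_eq[of "X \<union> Y"] assms by (auto simp: plus_rank_def)
qed

end

lemma plus_ext_empty:
  assumes "A \<subseteq> ground M"
  shows "plus_ext M A {} {} = M"
proof -
  have "plus_rank M A {} I = rank M I" if "I \<subseteq> ground M" for I
    using that rank_mono[of I "I \<union> A"] by (simp add: plus_rank_def Int_absorb2)
  then have "I \<in> indep (plus_ext M A {} {}) \<longleftrightarrow> I \<in> indep M" for I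
    by (cases "I \<subseteq> ground M")
      (simp_all add: plus_ext_def matroid_of_rank_def indep_iff_rank, blast dest: indep_subset_ground)
  then have "indep (plus_ext M A {} {}) = indep M" by blast
  then show ?thesis by (simp add: plus_ext_def matroid_of_rank_def)
qed

lemma plus_ext_insert:
  assumes A: "A \<subseteq> ground M" and B: "B \<subseteq> T" and T: "finite T" "T \<inter> ground M = {}"
    and e: "e \<notin> ground M \<union> T"
  defines "P \<equiv> plus_ext M A B T"
  shows "plus_ext M A (insert e B) (insert e T) = principal_ext P (closure P A) e"
proof -
  let ?S = "ground M" and ?Q = "plus_ext M A (insert e B) (insert e T)"
  interpret P: matroid P unfolding P_def by (rule matroid_plus_ext[OF A B T])
  have T': "finite (insert e T)" "insert e T \<inter> ?S = {}" "insert e B \<subseteq> insert e T"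
    using T B e by auto
  interpret Q: matroid ?Q by (rule matroid_plus_ext[OF A T'(3,1,2)])
  have gP: "ground P = ?S \<union> T" by (simp add: P_def plus_ext_def matroid_of_rank_def)
  have gQ: "ground ?Q = insert e (?S \<union> T)" by (simp add: plus_ext_def matroid_of_rank_def)
  have rP: "rank P Z = plus_rank M A B Z" if "Z \<subseteq> ?S \<union> T" for Z
    unfolding P_def by (rule rank_plus_ext_eq[OF A B T that])
  have finB: "finite B" using B T finite_subset by blast
  have old: "I \<in> indep ?Q \<longleftrightarrow> I \<in> indep P" if "e \<notin> I" for I
    using that by (auto simp: P_def plus_ext_def matroid_of_rank_def plus_rank_def)
  have cl: "closure P A \<subseteq> closure P Z \<longleftrightarrow> rank M (Z \<inter> ?S \<union> A) \<le> rank P Z"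
    if Z: "Z \<subseteq> ?S \<union> T" for Z
  proof -
    have ZA: "rank P (Z \<union> A) = rank M (Z \<inter> ?S \<union> A)"
    proof -
      have "(Z \<union> A) \<inter> ?S = Z \<inter> ?S \<union> A" using A by auto
      then show ?thesis using rP[of "Z \<union> A"] Z A by (auto simp: plus_rank_def Un_assoc)
    qed
    have span: "rank P (V \<union> D) = rank P V" if "finite D" "D \<subseteq> closure P V" for V D
      using that
    proof (induction D rule: finite_induct)
      case (insert x D)
      have "rank P (insert x V \<union> (V \<union> D)) + rank P (insert x V \<inter> (V \<union> D))
          \<le> rank P (insert x V) + rank P (V \<union> D)" by (rule P.rank_submodular)
      moreover have "rank P V \<le> rank P (insert x V \<inter> (V \<union> D))" by (rule P.rank_mono) auto
      moreover have "rank P V \<le> rank P (V \<union> insert x D)" by (rule P.rank_mono) auto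
      moreover have "insert x V \<union> (V \<union> D) = V \<union> insert x D" by auto
      ultimately show ?case using insert by (simp add: closure_def)
    qed simp
    have finA: "finite A" using A finite_ground finite_subset by blast
    show ?thesis
    proof
      assume l: "closure P A \<subseteq> closure P Z"
      have "A \<subseteq> closure P A" using A gP by (auto simp: closure_def insert_absorb)
      then have "rank P (Z \<union> A) = rank P Z" using l span[OF finA] by auto
      then show "rank M (Z \<inter> ?S \<union> A) \<le> rank P Z" using ZA by simp
    next
      assume "rank M (Z \<inter> ?S \<union> A) \<le> rank P Z"
      then have eq: "rank P (Z \<union> A) = rank P Z"
        using ZA P.rank_mono[of Z "Z \<union> A"] by simp
      show "closure P A \<subseteq> closure P Z"
      proof
        fix x assume x: "x \<in> closure P A"
        have "rank P (insert x A \<union> (Z \<union> A)) + rank P (insert x A \<inter> (Z \<union> A))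
            \<le> rank P (insert x A) + rank P (Z \<union> A)" by (rule P.rank_submodular)
        moreover have "rank P A \<le> rank P (insert x A \<inter> (Z \<union> A))" by (rule P.rank_mono) auto
        moreover have "rank P (insert x Z) \<le> rank P (insert x A \<union> (Z \<union> A))"
          "rank P Z \<le> rank P (insert x Z)" by (auto intro!: P.rank_mono)
        ultimately show "x \<in> closure P Z" using x eq by (simp add: closure_def)
      qed
    qed
  qed
  have new: "insert e Z \<in> indep ?Q \<longleftrightarrow> Z \<in> indep P \<and> \<not> closure P A \<subseteq> closure P Z"
    if Z: "e \<notin> Z" for Z
  proof (cases "Z \<subseteq> ?S \<union> T")
    case False
    then have "\<not> insert e Z \<subseteq> ground ?Q" "\<not> Z \<subseteq> ground P" using gQ gP Z by auto
    then show ?thesis using Q.indep_subset_ground P.indep_subset_ground by blast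
  next
    case True
    have finZ: "finite Z" using True T finite_ground by (meson finite_Un finite_subset)
    have eqs: "insert e Z \<inter> ?S = Z \<inter> ?S" "insert e Z \<inter> insert e B = insert e (Z \<inter> B)"
      using e Z B by auto
    have "rank ?Q (insert e Z) = plus_rank M A (insert e B) (insert e Z)"
      using True by (intro rank_plus_ext_eq[OF A T'(3,1,2)]) auto
    also have "\<dots> = min (rank M (Z \<inter> ?S \<union> A)) (rank M (Z \<inter> ?S) + Suc (card (Z \<inter> B)))"
      using eqs finZ Z by (simp add: plus_rank_def)
    finally have rQ: "rank ?Q (insert e Z) = \<dots>" .
    have rZ: "rank P Z = min (rank M (Z \<inter> ?S \<union> A)) (rank M (Z \<inter> ?S) + card (Z \<inter> B))"
      using rP[OF True] by (simp add: plus_rank_def)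
    have iQ: "insert e Z \<in> indep ?Q \<longleftrightarrow> rank ?Q (insert e Z) = Suc (card Z)"
      using Q.indep_iff_rank[of "insert e Z"] True gQ finZ Z by auto
    have iP: "Z \<in> indep P \<longleftrightarrow> rank P Z = card Z"
      using P.indep_iff_rank[of Z] True gP by auto
    show ?thesis
      unfolding iQ iP cl[OF True] using rQ rZ P.rank_le_card[OF finZ] by linarith
  qed
  have "I \<in> indep ?Q \<longleftrightarrow>
      I - {e} \<in> indep P \<and> (e \<in> I \<longrightarrow> \<not> closure P A \<subseteq> closure P (I - {e}))" for I
    using old[of I] new[of "I - {e}"] by (cases "e \<in> I") (auto simp: insert_absorb)
  then have "indep ?Q = indep (principal_ext P (closure P A) e)"
    unfolding principal_ext_def by auto
  moreover have "ground ?Q = ground (principal_ext P (closure P A) e)"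
    using gP gQ by (simp add: principal_ext_def)
  ultimately show ?thesis by (intro matroid.equality) simp_all
qed

lemma plus_ext_loop:
  assumes A: "A \<subseteq> ground M" and B: "B \<subseteq> T" and T: "finite T" "T \<inter> ground M = {}"
    and e: "e \<notin> ground M \<union> T"
  shows "plus_ext M A B (insert e T) = direct_sum (plus_ext M A B T) (uniform 0 {e})"
proof -
  have "{I. I \<subseteq> {e} \<and> card I = 0} = {{}}" by (auto dest: finite_subset)
  then have ds: "indep (direct_sum P (uniform 0 {e})) = indep P" for P
    by (auto simp: direct_sum_def uniform_def)
  have e_B: "e \<notin> B" using B e by auto
  have "e \<notin> I" if I: "I \<subseteq> ground M \<union> insert e T" "plus_rank M A B I = card I" for I
  proof
    assume eI: "e \<in> I"
    interpret P: matroid "plus_ext M A B T" by (rule matroid_plus_ext[OF A B T])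
    have finI: "finite I" using I(1) T finite_ground by (meson finite_Un finite_insert finite_subset)
    have "plus_rank M A B I = plus_rank M A B (I - {e})"
      using e e_B by (simp add: plus_rank_def Diff_Int_distrib2)
    also have "\<dots> = rank (plus_ext M A B T) (I - {e})"
      using I(1) by (intro rank_plus_ext_eq[OF A B T, symmetric]) auto
    also have "\<dots> \<le> card (I - {e})" using finI by (intro P.rank_le_card) auto
    also have "\<dots> < card I" using card_Diff1_less[OF finI eI] .
    finally show False using I(2) by simp
  qed
  then have "indep (plus_ext M A B (insert e T)) = indep (plus_ext M A B T)"
    by (auto simp: plus_ext_def matroid_of_rank_def)
  then show ?thesis
    using ds[of "plus_ext M A B T"]
    by (simp add: direct_sum_def uniform_def plus_ext_def matroid_of_rank_def)
qed

end

end

theory Submission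
  imports Defs
begin

text \<open>
  A set \<open>W\<close> is independent in \<open>(M, N; A, B)\<close> iff its part \<open>X\<close> in \<open>S\<close> is independent in \<open>M\<close> and
  its part in \<open>T\<close> becomes independent in \<open>N\<close> after deleting some set of at most
  \<open>r\<^sub>M(X \<union> A) - |X|\<close> elements of \<open>B\<close>. A basis of \<open>X \<union> A\<close> together with a basis of \<open>Y \<union> B\<close> is independent in the
  principal sum \<open>P\<close>, whence \<open>r\<^sub>P(X \<union> A \<union> Y \<union> B) = r\<^sub>M(X \<union> A) + r\<^sub>N(Y \<union> B)\<close>. With these two facts
  both iterated sums get the same independent sets \<open>X \<union> Y \<union> Z\<close>: the deletions \<open>Y' \<subseteq> Y \<inter> B\<close> and
  \<open>Z' \<subseteq> Z \<inter> C\<close> must satisfy \<open>|X| + |Y'| \<le> r\<^sub>M(X \<union> A)\<close> and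
  \<open>|X| + |Y| + |Z'| \<le> r\<^sub>M(X \<union> A) + r\<^sub>N(Y \<union> B)\<close>.
\<close>

section \<open>Rank and independence in the extension \<open>plus_ext\<close> over a set
  system\<close>

text \<open>Working with bare set systems avoids the matroid union theorem, which would be needed to see
  that a principal sum is a matroid.\<close>

locale set_system =
  fixes M :: "'a matroid"
  assumes finite_ground: "finite (ground M)"
    and indep_subset_ground: "I \<in> indep M \<Longrightarrow> I \<subseteq> ground M"
    and empty_indep: "{} \<in> indep M"
begin

lemma finite_indep: "I \<in> indep M \<Longrightarrow> finite I"
  using finite_ground indep_subset_ground finite_subset by blast

lemma finite_indeps: "finite {I \<in> indep M. I \<subseteq> X}"
  by (rule finite_subset[of _ "Pow (ground M)"]) (use finite_ground indep_subset_ground in auto)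

lemma rank_ge: "I \<in> indep M \<Longrightarrow> I \<subseteq> X \<Longrightarrow> card I \<le> rank M X"
  unfolding rank_def using finite_indeps by (intro Max_ge) auto

lemma rank_obtain: obtains I where "I \<in> indep M" "I \<subseteq> X" "card I = rank M X"
proof -
  have "rank M X \<in> card ` {I \<in> indep M. I \<subseteq> X}"
    unfolding rank_def using finite_indeps empty_indep by (intro Max_in) auto
  then show ?thesis using that by auto
qed

lemma rank_mono: "X \<subseteq> Y \<Longrightarrow> rank M X \<le> rank M Y"
  by (metis rank_obtain rank_ge subset_trans)

lemma rank_le_card: "finite X \<Longrightarrow> rank M X \<le> card X"
  by (metis rank_obtain card_mono)

text \<open>Only \<open>X\<close> itself is a subset of \<open>X\<close> with \<open>card X\<close>
  elements, so the maximum reaches \<open>card X\<close> exactly when \<open>X\<close> is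
  independent.\<close>

lemma indep_iff_rank: "finite X \<Longrightarrow> X \<in> indep M \<longleftrightarrow> rank M X = card X"
  by (metis rank_obtain card_subset_eq rank_ge rank_le_card le_antisym subset_refl)

text \<open>The second term of the minimum in \<open>plus_rank\<close> is at most
  \<open>card I\<close>, summand by summand. Rank \<open>card I\<close> therefore forces equality in
  both summands, which gives the first two conditions; the first term of the minimum gives the
  third.\<close>

lemma indep_plus_ext:
  assumes T: "finite T" "ground M \<inter> T = {}" and B: "B \<subseteq> T"
  shows "I \<in> indep (plus_ext M A B T) \<longleftrightarrow>
    I \<inter> ground M \<in> indep M \<and> I - ground M \<subseteq> B \<and> card I \<le> rank M (I \<inter> ground M \<union> A)"
    (is "?l \<longleftrightarrow> ?r")
proof (cases "I \<subseteq> ground M \<union> T")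
  case False
  then show ?thesis using B by (auto simp: plus_ext_def matroid_of_rank_def)
next
  case True
  let ?X = "I \<inter> ground M" and ?Y = "I - ground M"
  have fin: "finite I" using True T finite_ground by (meson finite_Un finite_subset)
  have IB: "I \<inter> B = ?Y \<inter> B" using B T by auto
  have cI: "card I = card ?X + card ?Y" using card_Int_Diff[OF fin] .
  have leX: "rank M ?X \<le> card ?X" using fin by (intro rank_le_card) auto
  have leY: "card (?Y \<inter> B) \<le> card ?Y" using fin by (intro card_mono) auto
  have eqY: "card (?Y \<inter> B) = card ?Y \<longleftrightarrow> ?Y \<subseteq> B"
    using fin by (metis Int_absorb2 card_subset_eq finite_Diff inf_le1 inf_le2)
  have "?l \<longleftrightarrow> min (rank M (?X \<union> A)) (rank M ?X + card (?Y \<inter> B)) = card ?X + card ?Y"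
    using True IB cI by (simp add: plus_ext_def matroid_of_rank_def plus_rank_def)
  also have "\<dots> \<longleftrightarrow> rank M ?X = card ?X \<and> card (?Y \<inter> B) = card ?Y \<and>
      card ?X + card ?Y \<le> rank M (?X \<union> A)"
    using leX leY by linarith
  also have "\<dots> \<longleftrightarrow> ?r" using eqY cI indep_iff_rank[of ?X] fin by simp
  finally show ?thesis .
qed

end

lemma (in matroid) set_system: "set_system M"
  by unfold_locales (use finite_ground indep_subset_ground empty_indep in auto)

section \<open>Independent sets and rank of one principal sum\<close>

lemma ground_principal_sum: "ground (principal_sum M N A B) = ground M \<union> ground N"
  by (auto simp: principal_sum_def matroid_union_def plus_ext_def matroid_of_rank_def
      direct_sum_def uniform_def)

context
  fixes M N :: "'a matroid" and A B :: "'a set"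
  assumes M: "set_system M" and N: "set_system N"
    and disj: "ground M \<inter> ground N = {}" and B: "B \<subseteq> ground N"
begin

interpretation M: set_system M by (fact M)
interpretation N: set_system N by (fact N)

text \<open>In a decomposition of \<open>W\<close> into an independent set of the extension and one
  of \<open>N\<close>, the former contains all of \<open>W \<inter> ground M\<close>, since these
  elements are loops in the latter. \<open>Y\<close> is what it contributes outside
  \<open>ground M\<close>.\<close>

lemma indep_principal_sum:
  "W \<in> indep (principal_sum M N A B) \<longleftrightarrow> W \<inter> ground M \<in> indep M \<and>
    (\<exists>Y \<subseteq> W \<inter> B. W - ground M - Y \<in> indep N \<and>
       card (W \<inter> ground M) + card Y \<le> rank M (W \<inter> ground M \<union> A))"
proof -
  have u: "indep (direct_sum N (uniform 0 (ground M))) = indep N"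
  proof -
    \<comment> \<open>Infinite sets also have \<open>card\<close> 0; finiteness of
      \<open>ground M\<close> excludes them.\<close>
    have "{I. I \<subseteq> ground M \<and> card I \<le> 0} = {{}}"
      using M.finite_ground by (auto dest: finite_subset)
    then show ?thesis by (simp add: direct_sum_def uniform_def)
  qed
  have "W \<in> indep (principal_sum M N A B) \<longleftrightarrow>
      (\<exists>I J. W = I \<union> J \<and> I \<in> indep (plus_ext M A B (ground N)) \<and> J \<in> indep N)"
    using u by (auto simp: principal_sum_def matroid_union_def)
  also have "\<dots> \<longleftrightarrow> W \<inter> ground M \<in> indep M \<and>
    (\<exists>Y \<subseteq> W \<inter> B. W - ground M - Y \<in> indep N \<and>
       card (W \<inter> ground M) + card Y \<le> rank M (W \<inter> ground M \<union> A))" (is "?l \<longleftrightarrow> ?r")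
  proof
    assume ?l
    then obtain I J where IJ: "W = I \<union> J" "J \<in> indep N" "I \<inter> ground M \<in> indep M"
      "I - ground M \<subseteq> B" "card I \<le> rank M (I \<inter> ground M \<union> A)"
      using M.indep_plus_ext[OF N.finite_ground disj B] by blast
    have J: "J \<subseteq> ground N" using N.indep_subset_ground IJ(2) .
    have WM: "W \<inter> ground M = I \<inter> ground M" using IJ(1) J disj by auto
    have "finite (I - ground M)" using IJ(4) B N.finite_ground by (meson finite_subset)
    then have fin: "finite I" using M.finite_ground by (meson finite_Diff2)
    \<comment> \<open>Removing \<open>J\<close> here leaves exactly \<open>J\<close> for
      \<open>N\<close>; in a set system a smaller remainder might not be independent.\<close>
    let ?Y = "I - ground M - J"
    have "W - ground M - ?Y = J" using IJ(1) J disj by auto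
    moreover have "card (I \<inter> ground M) + card ?Y \<le> card I"
      using card_Int_Diff[OF fin, of "ground M"] card_mono[of "I - ground M" ?Y] fin by auto
    ultimately show ?r using IJ WM by (intro conjI exI[of _ ?Y]) auto
  next
    assume r: ?r
    then obtain Y where Y: "Y \<subseteq> W \<inter> B" "W - ground M - Y \<in> indep N"
      "card (W \<inter> ground M) + card Y \<le> rank M (W \<inter> ground M \<union> A)" by blast
    let ?I = "W \<inter> ground M \<union> Y"
    have YM: "Y \<inter> ground M = {}" using Y(1) B disj by auto
    then have I: "?I \<inter> ground M = W \<inter> ground M" "?I - ground M = Y" by auto
    have "card ?I \<le> rank M (W \<inter> ground M \<union> A)"
      using card_Un_le[of "W \<inter> ground M" Y] Y(3) by linarith
    then have "?I \<in> indep (plus_ext M A B (ground N))"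
      unfolding M.indep_plus_ext[OF N.finite_ground disj B] I using r Y(1) by blast
    moreover have "W = ?I \<union> (W - ground M - Y)" using Y(1) by auto
    ultimately show ?l using Y(2) by blast
  qed
  finally show ?thesis .
qed

text \<open>This lets a principal sum serve as an operand of another one.\<close>

lemma set_system_principal_sum: "set_system (principal_sum M N A B)"
proof
  show "I \<subseteq> ground (principal_sum M N A B)" if "I \<in> indep (principal_sum M N A B)" for I
    using that B N.indep_subset_ground unfolding indep_principal_sum ground_principal_sum by blast
qed (use M.finite_ground N.finite_ground M.empty_indep N.empty_indep in
    \<open>auto simp: ground_principal_sum indep_principal_sum\<close>)

interpretation P: set_system "principal_sum M N A B" by (fact set_system_principal_sum)

text \<open>For the upper bound, the deleted elements are charged to \<open>M\<close>: together with
  \<open>W \<inter> ground M\<close> they number at most \<open>rank M X\<close>, because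
  \<open>A \<subseteq> X\<close>. The rest is independent in \<open>N\<close> and lies in
  \<open>Y\<close>.\<close>

lemma rank_principal_sum:
  assumes "A \<subseteq> X" "X \<subseteq> ground M" "B \<subseteq> Y" "Y \<subseteq> ground N"
  shows "rank (principal_sum M N A B) (X \<union> Y) = rank M X + rank N Y"
proof (rule antisym)
  obtain W where W: "W \<in> indep (principal_sum M N A B)" "W \<subseteq> X \<union> Y"
    "card W = rank (principal_sum M N A B) (X \<union> Y)" by (rule P.rank_obtain)
  then obtain D where D: "D \<subseteq> W \<inter> B" "W - ground M - D \<in> indep N"
      "card (W \<inter> ground M) + card D \<le> rank M (W \<inter> ground M \<union> A)"
    unfolding indep_principal_sum by blast
  have fin: "finite W" using P.finite_indep W(1) .
  have "D \<subseteq> W - ground M" using D(1) B disj by auto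
  then have "card (W - ground M) = card D + card (W - ground M - D)"
    using fin by (metis card_Diff_subset card_mono finite_Diff finite_subset le_add_diff_inverse)
  moreover have "rank M (W \<inter> ground M \<union> A) \<le> rank M X"
    using W(2) assms disj by (intro M.rank_mono) auto
  moreover have "card (W - ground M - D) \<le> rank N Y"
    using W(2) assms by (intro N.rank_ge D(2)) auto
  ultimately show "rank (principal_sum M N A B) (X \<union> Y) \<le> rank M X + rank N Y"
    using card_Int_Diff[OF fin, of "ground M"] W(3) D(3) by linarith
next
  obtain I where I: "I \<in> indep M" "I \<subseteq> X" "card I = rank M X" by (rule M.rank_obtain)
  obtain J where J: "J \<in> indep N" "J \<subseteq> Y" "card J = rank N Y" by (rule N.rank_obtain)
  have sub: "I \<subseteq> ground M" "J \<subseteq> ground N"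
    using I(1) J(1) M.indep_subset_ground N.indep_subset_ground by auto
  then have eqs: "(I \<union> J) \<inter> ground M = I" "I \<union> J - ground M = J" "I \<inter> J = {}"
    using disj by auto
  \<comment> \<open>So \<open>I \<union> J\<close> is independent with nothing deleted.\<close>
  have "card I \<le> rank M (I \<union> A)" by (rule M.rank_ge[OF I(1)]) auto
  then have "I \<union> J \<in> indep (principal_sum M N A B)"
    unfolding indep_principal_sum eqs using I J by (auto intro!: exI[of _ "{}"])
  then have "card (I \<union> J) \<le> rank (principal_sum M N A B) (X \<union> Y)"
    using I J by (intro P.rank_ge) auto
  then show "rank M X + rank N Y \<le> rank (principal_sum M N A B) (X \<union> Y)"
    using I J eqs(3) by (simp add: card_Un_disjoint M.finite_indep N.finite_indep)
qed

end

section \<open>A common description of the independent sets of both iterated sums\<close>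

context
  fixes M N K :: "'a matroid" and S T U A B C :: "'a set"
  assumes M: "set_system M" and S: "ground M = S"
    and N: "set_system N" and T: "ground N = T"
    and K: "set_system K" and U: "ground K = U"
    and disj: "S \<inter> T = {}" "S \<inter> U = {}" "T \<inter> U = {}"
    and A: "A \<subseteq> S" and B: "B \<subseteq> T" and C: "C \<subseteq> U"
begin

interpretation M: set_system M by (fact M)
interpretation N: set_system N by (fact N)
interpretation K: set_system K by (fact K)

text \<open>The characterization is applied twice. The outer bound is the rank of a set containing
  \<open>A \<union> B\<close>, which \<open>rank_principal_sum\<close> splits into a rank in
  \<open>M\<close> and a rank in \<open>N\<close>.\<close>

lemma indep_principal_sum_left:
  "W \<in> indep (principal_sum (principal_sum M N A B) K (A \<union> B) C) \<longleftrightarrow>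
    W \<inter> S \<in> indep M \<and>
    (\<exists>Y \<subseteq> W \<inter> B. W \<inter> T - Y \<in> indep N \<and> card (W \<inter> S) + card Y \<le> rank M (W \<inter> S \<union> A)) \<and>
    (\<exists>Z \<subseteq> W \<inter> C. W - S - T - Z \<in> indep K \<and>
      card (W \<inter> S) + card (W \<inter> T) + card Z \<le> rank M (W \<inter> S \<union> A) + rank N (W \<inter> T \<union> B))"
proof -
  let ?P = "principal_sum M N A B"
  have dMN: "ground M \<inter> ground N = {}" and BN: "B \<subseteq> ground N" using S T disj B by auto
  have P: "set_system ?P" by (rule set_system_principal_sum[OF M N dMN BN])
  have gP: "ground ?P = S \<union> T" by (simp add: ground_principal_sum S T)
  have 1: "ground ?P \<inter> ground K = {}" and CU: "C \<subseteq> ground K"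
    using gP U disj C by auto
  have e: "W \<inter> (S \<union> T) \<inter> S = W \<inter> S" "W \<inter> (S \<union> T) - S = W \<inter> T" "W \<inter> (S \<union> T) \<inter> B = W \<inter> B"
    "W - (S \<union> T) = W - S - T" "W \<inter> (S \<union> T) \<union> (A \<union> B) = W \<inter> S \<union> A \<union> (W \<inter> T \<union> B)"
    using disj B by auto
  have r: "rank ?P (W \<inter> S \<union> A \<union> (W \<inter> T \<union> B)) = rank M (W \<inter> S \<union> A) + rank N (W \<inter> T \<union> B)"
    using A B S T by (intro rank_principal_sum[OF M N dMN BN]) auto
  have c: "card (W \<inter> (S \<union> T)) = card (W \<inter> S) + card (W \<inter> T)"
    unfolding Int_Un_distrib using M.finite_ground N.finite_ground S T disj
    by (intro card_Un_disjoint) auto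
  show ?thesis
    unfolding indep_principal_sum[OF P K 1 CU] gP indep_principal_sum[OF M N dMN BN] S e r c
    by (simp add: conj_assoc)
qed

text \<open>Here elements of \<open>C\<close> can be deleted twice: by the outer sum, charged to
  \<open>M\<close> along with \<open>Y\<close>, and by the inner sum, charged to \<open>N\<close>.
  Only the total number matters.\<close>

lemma indep_principal_sum_right:
  "W \<in> indep (principal_sum M (principal_sum N K B C) A (B \<union> C)) \<longleftrightarrow>
    W \<inter> S \<in> indep M \<and>
    (\<exists>Y \<subseteq> W \<inter> B. W \<inter> T - Y \<in> indep N \<and> card (W \<inter> S) + card Y \<le> rank M (W \<inter> S \<union> A)) \<and>
    (\<exists>Z \<subseteq> W \<inter> C. W - S - T - Z \<in> indep K \<and>
      card (W \<inter> S) + card (W \<inter> T) + card Z \<le> rank M (W \<inter> S \<union> A) + rank N (W \<inter> T \<union> B))"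
    (is "?l \<longleftrightarrow> ?X \<and> ?Y \<and> ?Z")
proof -
  let ?Q = "principal_sum N K B C"
  have dNK: "ground N \<inter> ground K = {}" and CK: "C \<subseteq> ground K" using T U disj C by auto
  have Q: "set_system ?Q" by (rule set_system_principal_sum[OF N K dNK CK])
  have 1: "ground M \<inter> ground ?Q = {}" and 2: "B \<union> C \<subseteq> ground ?Q"
    using S T U disj B C by (auto simp: ground_principal_sum)
  note indep_right = indep_principal_sum[OF M Q 1 2, unfolded S]
  note indep_Q = indep_principal_sum[OF N K dNK CK, unfolded T]
  have finT: "finite T" and finU: "finite U" using N.finite_ground K.finite_ground T U by auto
  have finY: "finite Y" if "Y \<subseteq> W \<inter> B" for Y using finite_subset[of Y T] that B finT by auto
  have finZ: "finite Z" if "Z \<subseteq> W \<inter> C" for Z using finite_subset[of Z U] that C finU by auto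
  have cardY: "card (W \<inter> T - Y) + card Y = card (W \<inter> T)" if "Y \<subseteq> W \<inter> B" for Y
  proof -
    have "card (W \<inter> T) = card (W \<inter> T - Y \<union> Y)" using that B by (intro arg_cong[of _ _ card]) auto
    also have "\<dots> = card (W \<inter> T - Y) + card Y"
      using finY[OF that] finT by (intro card_Un_disjoint) auto
    finally show ?thesis by simp
  qed
  have eT: "(W - S - (Y \<union> Z)) \<inter> T = W \<inter> T - Y" "W \<inter> T - Y \<union> B = W \<inter> T \<union> B"
    "Y \<inter> Z = {}" if "Y \<subseteq> W \<inter> B" "Z \<subseteq> W \<inter> C" for Y Z
    using that B C disj by blast+
  have eU: "W - S - (Y \<union> Z) - T - Z' = W - S - T - (Z \<union> Z')" if "Y \<subseteq> W \<inter> B" for Y Z Z'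
    using that B by blast
  show ?thesis
  proof
    assume ?l
    then obtain D where D: "W \<inter> S \<in> indep M" "D \<subseteq> W \<inter> (B \<union> C)" "W - S - D \<in> indep ?Q"
      "card (W \<inter> S) + card D \<le> rank M (W \<inter> S \<union> A)" unfolding indep_right by blast
    define Y Z where "Y = D \<inter> B" and "Z = D \<inter> C"
    have YZ: "Y \<subseteq> W \<inter> B" "Z \<subseteq> W \<inter> C" and DYZ: "D = Y \<union> Z" using D(2) by (auto simp: Y_def Z_def)
    obtain Z' where Z': "W \<inter> T - Y \<in> indep N" "Z' \<subseteq> W \<inter> C" "W - S - T - (Z \<union> Z') \<in> indep K"
        "card (W \<inter> T - Y) + card Z' \<le> rank N (W \<inter> T \<union> B)"
      using D(3) unfolding DYZ indep_Q eT[OF YZ] eU[OF YZ(1)] by blast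
    have cD: "card D = card Y + card Z"
      unfolding DYZ using finY finZ YZ eT(3)[OF YZ] by (intro card_Un_disjoint) auto
    have ?Y using YZ(1) Z'(1) D(4) cD by (intro exI[of _ Y]) auto
    \<comment> \<open>The bounds of the outer and inner sum are added; \<open>card Y\<close> from
      the first completes \<open>card (W \<inter> T - Y)\<close> from the second to
      \<open>card (W \<inter> T)\<close>.\<close>
    moreover have "card (W \<inter> S) + card (W \<inter> T) + card (Z \<union> Z')
        \<le> rank M (W \<inter> S \<union> A) + rank N (W \<inter> T \<union> B)"
      using D(4) cD Z'(4) cardY[OF YZ(1)] card_Un_le[of Z Z'] by linarith
    then have ?Z using Z' YZ by (intro exI[of _ "Z \<union> Z'"]) auto
    ultimately show "?X \<and> ?Y \<and> ?Z" using D(1) by blast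
  next
    assume r: "?X \<and> ?Y \<and> ?Z"
    then obtain Y Z where Y: "Y \<subseteq> W \<inter> B" "W \<inter> T - Y \<in> indep N"
        "card (W \<inter> S) + card Y \<le> rank M (W \<inter> S \<union> A)"
      and Z: "Z \<subseteq> W \<inter> C" "W - S - T - Z \<in> indep K"
        "card (W \<inter> S) + card (W \<inter> T) + card Z \<le> rank M (W \<inter> S \<union> A) + rank N (W \<inter> T \<union> B)"
      by blast
    text \<open>The set \<open>Z\<close> is deleted in two steps: the deletions from \<open>M\<close> use as much as possible of
      the slack left by \<open>Y\<close>, and the slack of \<open>N\<close> suffices for the rest.\<close>
    define k where "k = min (card Z) (rank M (W \<inter> S \<union> A) - card (W \<inter> S) - card Y)"
    obtain Z1 where Z1: "Z1 \<subseteq> Z" "card Z1 = k"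
      using obtain_subset_with_card_n[of k Z] by (auto simp: k_def)
    have Z1W: "Z1 \<subseteq> W \<inter> C" using Z1 Z by auto
    have "card (Z - Z1) = card Z - k"
      using Z1 finZ[OF Z1W] by (simp add: card_Diff_subset)
    moreover have "card (W \<inter> T - Y) \<le> rank N (W \<inter> T \<union> B)" by (rule N.rank_ge[OF Y(2)]) auto
    \<comment> \<open>If \<open>k = card Z\<close>, nothing is left to delete and the preceding
      bound suffices. Otherwise \<open>card (W \<inter> S) + card Y + k\<close> equals
      \<open>rank M (W \<inter> S \<union> A)\<close>, and subtracting this from the joint bound
      leaves the claim.\<close>
    ultimately have "card (W \<inter> T - Y) + card (Z - Z1) \<le> rank N (W \<inter> T \<union> B)"
      using Z(3) Y(3) cardY[OF Y(1)] unfolding k_def by linarith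
    moreover have "Z1 \<union> (Z - Z1) = Z" using Z1 by auto
    moreover have "Z - Z1 \<subseteq> (W - S - (Y \<union> Z1)) \<inter> C" using Z(1) Y(1) B C disj by blast
    ultimately have "W - S - (Y \<union> Z1) \<in> indep ?Q"
      unfolding indep_Q eT[OF Y(1) Z1W] eU[OF Y(1)] using Y(2) Z(2)
      by (intro conjI exI[of _ "Z - Z1"]) auto
    moreover have "card (W \<inter> S) + card (Y \<union> Z1) \<le> rank M (W \<inter> S \<union> A)"
      using card_Un_le[of Y Z1] Z1(2) Y(3) unfolding k_def by linarith
    ultimately show ?l
      unfolding indep_right using r Y(1) Z1W by (intro conjI exI[of _ "Y \<union> Z1"]) auto
  qed
qed

end

theorem theorem3p21:
  fixes M N K :: "'a matroid" and S T U A B C :: "'a set"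
  assumes "matroid M" "ground M = S"
    and "matroid N" "ground N = T"
    and "matroid K" "ground K = U"
    and "S \<inter> T = {}" "S \<inter> U = {}" "T \<inter> U = {}"
    and "A \<subseteq> S" "B \<subseteq> T" "C \<subseteq> U"
  shows "principal_sum (principal_sum M N A B) K (A \<union> B) C =
         principal_sum M (principal_sum N K B C) A (B \<union> C)"
proof (rule matroid.equality)
  note systems = assms(1,3,5)[THEN matroid.set_system]
  note hyps = systems(1) assms(2) systems(2) assms(4) systems(3) assms(6-12)
  show "indep (principal_sum (principal_sum M N A B) K (A \<union> B) C) =
        indep (principal_sum M (principal_sum N K B C) A (B \<union> C))"
    by (intro set_eqI)
      (simp only: indep_principal_sum_left[OF hyps] indep_principal_sum_right[OF hyps])
qed (simp_all add: ground_principal_sum Un_assoc)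

end
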